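(* For every $\varepsilon>0$ there is a bipartite graph $G$ such that the expected size of the matching returned by EDSM on $G$ is less than $(\tfrac12+\varepsilon)\,\nu(G)$, and the expected size of the matching returned by MDS on $G$ is less than $(\tfrac12+\varepsilon)\,\nu(G)$.
   Context: For a finite simple graph $G$, $\nu(G)$ denotes the size of a maximum matching. Both algorithms maintain a current graph (initially $G$) and a matching $M$ (initially empty); after an edge $\{u,v\}$ is added to $M$, the nodes $u,v$ and all their incident edges are deleted from the current graph; they stop when the current graph has no edges; all degrees are degrees in the current graph. EDSM (enhanced Degree-Sequenced Matching): choose a node $u$ of minimum degree among the non-isolated nodes of the current graph, and match it to a neighbor of $u$ that has minimum degree among all neighbors of $u$; all ties are broken uniformly at random. MDS (Minimum Degree Sum): choose an edge $\{u,v\}$ of the current graph minimizing $d(u)+d(v)$, ties broken uniformly at random, and add it to $M$. *)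

theory Defs
  imports "HOL-Probability.Probability"
begin

definition sgraph :: "'a set \<Rightarrow> 'a set set \<Rightarrow> bool" where
  "sgraph V E \<longleftrightarrow> finite V \<and> (\<forall>e\<in>E. e \<subseteq> V \<and> card e = 2)"

definition bipartite :: "'a set \<Rightarrow> 'a set set \<Rightarrow> bool" where
  "bipartite V E \<longleftrightarrow>
     (\<exists>A B. A \<union> B = V \<and> A \<inter> B = {} \<and> (\<forall>e\<in>E. \<exists>a\<in>A. \<exists>b\<in>B. e = {a, b}))"

definition matching :: "'a set set \<Rightarrow> 'a set set \<Rightarrow> bool" where
  "matching E M \<longleftrightarrow> M \<subseteq> E \<and> pairwise disjnt M"

definition matching_number :: "'a set set \<Rightarrow> nat" where
  "matching_number E = Max (card ` {M. matching E M})"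

definition vdegree :: "'a set set \<Rightarrow> 'a \<Rightarrow> nat" where
  "vdegree E v = card {e \<in> E. v \<in> e}"

definition neighbors :: "'a set set \<Rightarrow> 'a \<Rightarrow> 'a set" where
  "neighbors E u = {v. {u, v} \<in> E}"

definition del_edges :: "'a set set \<Rightarrow> 'a set \<Rightarrow> 'a set set" where
  "del_edges E e = {f \<in> E. f \<inter> e = {}}"

definition minimizers :: "('b \<Rightarrow> nat) \<Rightarrow> 'b set \<Rightarrow> 'b set" where
  "minimizers f S = {x. is_arg_min f (\<lambda>y. y \<in> S) x}"

definition edsm_nodes :: "'a set \<Rightarrow> 'a set set \<Rightarrow> 'a set" where
  "edsm_nodes V E = minimizers (vdegree E) {u \<in> V. vdegree E u > 0}"

definition edsm_partners :: "'a set set \<Rightarrow> 'a \<Rightarrow> 'a set" where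
  "edsm_partners E u = minimizers (vdegree E) (neighbors E u)"

definition mds_edges :: "'a set set \<Rightarrow> 'a set set" where
  "mds_edges E = minimizers (\<lambda>e. \<Sum>v\<in>e. vdegree E v) E"

lemma minimizers_subset: "minimizers f S \<subseteq> S"
  by (auto simp: minimizers_def is_arg_min_def)

lemma minimizers_nonempty:
  assumes "S \<noteq> {}"
  shows "minimizers f S \<noteq> {}"
proof -
  obtain x where "x \<in> S" using assms by blast
  then have "is_arg_min f (\<lambda>y. y \<in> S) (arg_min f (\<lambda>y. y \<in> S))"
    using arg_min_nat_lemma[of "\<lambda>y. y \<in> S" x f] by (auto simp: is_arg_min_def not_less)
  then show ?thesis by (auto simp: minimizers_def)
qed

lemma sgraph_finite_edges: "sgraph V E \<Longrightarrow> finite E"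
  by (rule finite_subset[of E "Pow V"]) (auto simp: sgraph_def)

lemma sgraph_delete: "sgraph V E \<Longrightarrow> sgraph (V - e) (del_edges E e)"
  by (auto simp: sgraph_def del_edges_def)

lemma edsm_nodes_finite: "sgraph V E \<Longrightarrow> finite (edsm_nodes V E)"
  unfolding edsm_nodes_def sgraph_def
  by (rule finite_subset[OF minimizers_subset]) auto

lemma edsm_nodes_nonempty:
  assumes "sgraph V E" "E \<noteq> {}"
  shows "edsm_nodes V E \<noteq> {}"
proof -
  obtain e where e: "e \<in> E" using assms(2) by blast
  then have "e \<subseteq> V" "card e = 2" using assms(1) by (auto simp: sgraph_def)
  then obtain u where u: "u \<in> e" "u \<in> V" by (auto simp: card_2_iff)
  have "finite {f \<in> E. u \<in> f}" using sgraph_finite_edges[OF assms(1)] by simp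
  then have "vdegree E u > 0" using e u by (auto simp: vdegree_def card_gt_0_iff)
  then show ?thesis
    unfolding edsm_nodes_def using u by (intro minimizers_nonempty) auto
qed

lemma edsm_partners_finite:
  assumes "sgraph V E"
  shows "finite (edsm_partners E u)"
proof (rule finite_subset)
  show "edsm_partners E u \<subseteq> V"
    using assms minimizers_subset[of "vdegree E" "neighbors E u"]
    by (fastforce simp: edsm_partners_def neighbors_def sgraph_def)
  show "finite V" using assms by (simp add: sgraph_def)
qed

lemma edsm_partners_nonempty:
  assumes "sgraph V E" "u \<in> edsm_nodes V E"
  shows "edsm_partners E u \<noteq> {}"
proof -
  have "vdegree E u > 0"
    using assms(2) minimizers_subset by (fastforce simp: edsm_nodes_def)
  then have "{e \<in> E. u \<in> e} \<noteq> {}" by (auto simp: vdegree_def card_gt_0_iff)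
  then obtain e where e: "e \<in> E" "u \<in> e" by blast
  then have "card e = 2" using assms(1) by (auto simp: sgraph_def)
  then obtain v where "e = {u, v}"
    using e(2) by (auto simp: card_2_iff)
  then show ?thesis
    unfolding edsm_partners_def using e
    by (intro minimizers_nonempty) (auto simp: neighbors_def)
qed

lemma edsm_partners_edge: "v \<in> edsm_partners E u \<Longrightarrow> {u, v} \<in> E"
  using minimizers_subset by (fastforce simp: edsm_partners_def neighbors_def)

lemma mds_edges_subset: "mds_edges E \<subseteq> E"
  by (simp add: mds_edges_def minimizers_subset)

lemma mds_edges_nonempty: "E \<noteq> {} \<Longrightarrow> mds_edges E \<noteq> {}"
  by (simp add: mds_edges_def minimizers_nonempty)

lemma card_del_edges_less:
  assumes "sgraph V E" "e \<in> E"
  shows "card (del_edges E e) < card E"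
proof (rule psubset_card_mono)
  show "finite E" using sgraph_finite_edges[OF assms(1)] .
  have "e \<noteq> {}" using assms by (auto simp: sgraph_def)
  then show "del_edges E e \<subset> E" using assms(2) by (auto simp: del_edges_def)
qed

text \<open>The distributions of the final matching when a run starts from the current graph
  with nodes \<open>V\<close> and edges \<open>E\<close> and the matching \<open>M\<close>. The conjunct \<^term>\<open>sgraph V E\<close> in the
  guards only serves termination: it is preserved by every step, so that a run on
  a finite simple graph stops exactly when no edge is left.\<close>

function edsm :: "'a set \<Rightarrow> 'a set set \<Rightarrow> 'a set set \<Rightarrow> 'a set set pmf" where
  "edsm V E M =
     (if sgraph V E \<and> E \<noteq> {} then
        bind_pmf (pmf_of_set (edsm_nodes V E)) (\<lambda>u.
        bind_pmf (pmf_of_set (edsm_partners E u)) (\<lambda>v.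
          edsm (V - {u, v}) (del_edges E {u, v}) (insert {u, v} M)))
      else return_pmf M)"
  by pat_completeness auto
termination
proof (relation "Wellfounded.measure (\<lambda>(V, E, M). card E)")
  fix V :: "'a set" and E M u v
  assume G: "sgraph V E \<and> E \<noteq> {}"
    and u: "u \<in> set_pmf (pmf_of_set (edsm_nodes V E))"
    and v: "v \<in> set_pmf (pmf_of_set (edsm_partners E u))"
  have "u \<in> edsm_nodes V E"
    using u G edsm_nodes_finite edsm_nodes_nonempty by (metis set_pmf_of_set)
  then have "v \<in> edsm_partners E u"
    using v G edsm_partners_finite edsm_partners_nonempty by (metis set_pmf_of_set)
  then have "card (del_edges E {u, v}) < card E"
    using G card_del_edges_less edsm_partners_edge by metis
  then show "((V - {u, v}, del_edges E {u, v}, insert {u, v} M), V, E, M)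
      \<in> Wellfounded.measure (\<lambda>(V, E, M). card E)" by simp
qed simp

function mds :: "'a set \<Rightarrow> 'a set set \<Rightarrow> 'a set set \<Rightarrow> 'a set set pmf" where
  "mds V E M =
     (if sgraph V E \<and> E \<noteq> {} then
        bind_pmf (pmf_of_set (mds_edges E)) (\<lambda>e.
          mds (V - e) (del_edges E e) (insert e M))
      else return_pmf M)"
  by pat_completeness auto
termination
proof (relation "Wellfounded.measure (\<lambda>(V, E, M). card E)")
  fix V :: "'a set" and E M e
  assume G: "sgraph V E \<and> E \<noteq> {}" and e: "e \<in> set_pmf (pmf_of_set (mds_edges E))"
  have "finite (mds_edges E)"
    using G sgraph_finite_edges mds_edges_subset by (metis finite_subset)
  then have "e \<in> E"
    using e G mds_edges_nonempty mds_edges_subset by (metis set_pmf_of_set subsetD)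
  then show "((V - e, del_edges E e, insert e M), V, E, M)
      \<in> Wellfounded.measure (\<lambda>(V, E, M). card E)" using G \<open>e \<in> E\<close> card_del_edges_less[of V E e] by simp
qed simp

declare edsm.simps [simp del] mds.simps [simp del]

definition edsm_expected_size :: "'a set \<Rightarrow> 'a set set \<Rightarrow> real" where
  "edsm_expected_size V E = measure_pmf.expectation (edsm V E {}) (\<lambda>M. real (card M))"

definition mds_expected_size :: "'a set \<Rightarrow> 'a set set \<Rightarrow> real" where
  "mds_expected_size V E = measure_pmf.expectation (mds V E {}) (\<lambda>M. real (card M))"

end

theory Submission
  imports Defs
begin

text \<open>Take \<open>n\<close> disjoint paths on four nodes and, on each side of the bipartition, three
  hubs that are adjacent to all path ends on the other side. The inner nodes of the paths have
  degree 2, while path ends keep degree at least 3 even after their inner neighbor is gone. So both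
  algorithms first pick the middle edges of all \<open>n\<close> paths; afterwards every edge contains one of
  the six hubs. Hence every run returns at most \<open>n + 6\<close> edges, whereas the outer edges of the paths
  form a matching of size \<open>2 * n\<close>.\<close>

section \<open>Runs of greedy matching algorithms\<close>

text \<open>This forgets the probabilities: the size bound holds for every possible run, so only the
  supports of the distributions matter. \<open>S\<close> collects the edges that an algorithm may
  pick next, so one induction serves both algorithms. \<open>V\<close> is carried along because the
  choice in EDSM refers to the node set.\<close>

inductive greedy_run ::
  "('a set \<Rightarrow> 'a set set \<Rightarrow> 'a set set) \<Rightarrow> 'a set \<Rightarrow> 'a set set \<Rightarrow> 'a set set \<Rightarrow> 'a set set \<Rightarrow> bool"
  for S where
  stop: "greedy_run S V {} M M"
| step: "e \<in> S V E \<Longrightarrow> greedy_run S (V - e) (del_edges E e) (insert e M) N \<Longrightarrow> greedy_run S V E M N"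

definition edsm_choices :: "'a set \<Rightarrow> 'a set set \<Rightarrow> 'a set set" where
  "edsm_choices V E = {{u, v} |u v. u \<in> edsm_nodes V E \<and> v \<in> edsm_partners E u}"

definition mds_choices :: "'a set \<Rightarrow> 'a set set \<Rightarrow> 'a set set" where
  "mds_choices V E = mds_edges E"

lemma edsm_choices_subset: "edsm_choices V E \<subseteq> E"
  by (auto simp: edsm_choices_def dest: edsm_partners_edge)

lemma mds_choices_subset: "mds_choices V E \<subseteq> E"
  by (simp add: mds_choices_def mds_edges_subset)

text \<open>An outcome of positive probability arises from some node and partner in the supports of
  the two uniform choices. These supports are the minimizer sets themselves, which are finite and
  nonempty.\<close>

lemma edsm_greedy_run:
  assumes "sgraph V E" "N \<in> set_pmf (edsm V E M)"
  shows "greedy_run edsm_choices V E M N"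
  using assms
proof (induction "card E" arbitrary: V E M rule: less_induct)
  case less
  show ?case
  proof (cases "E = {}")
    case True
    then show ?thesis
      using less.prems by (subst (asm) edsm.simps) (simp add: greedy_run.stop)
  next
    case False
    note G = less.prems(1) False
    have "edsm V E M = bind_pmf (pmf_of_set (edsm_nodes V E)) (\<lambda>u.
        bind_pmf (pmf_of_set (edsm_partners E u)) (\<lambda>v.
          edsm (V - {u, v}) (del_edges E {u, v}) (insert {u, v} M)))"
      using G by (subst edsm.simps) simp
    then obtain u where u: "u \<in> set_pmf (pmf_of_set (edsm_nodes V E))"
      and "N \<in> set_pmf (bind_pmf (pmf_of_set (edsm_partners E u)) (\<lambda>v.
          edsm (V - {u, v}) (del_edges E {u, v}) (insert {u, v} M)))"
      using less.prems(2) by auto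
    then obtain v where v: "v \<in> set_pmf (pmf_of_set (edsm_partners E u))"
      and N: "N \<in> set_pmf (edsm (V - {u, v}) (del_edges E {u, v}) (insert {u, v} M))"
      by auto
    have u: "u \<in> edsm_nodes V E"
      using u set_pmf_of_set[OF edsm_nodes_nonempty[OF G] edsm_nodes_finite[OF G(1)]] by simp
    have v: "v \<in> edsm_partners E u"
      using v set_pmf_of_set[OF edsm_partners_nonempty[OF G(1) u] edsm_partners_finite[OF G(1)]] by simp
    have "card (del_edges E {u, v}) < card E"
      using card_del_edges_less[OF G(1) edsm_partners_edge[OF v]] .
    then have "greedy_run edsm_choices (V - {u, v}) (del_edges E {u, v}) (insert {u, v} M) N"
      using less.hyps sgraph_delete[OF G(1)] N by blast
    then show ?thesis
      by (rule greedy_run.step[rotated]) (use u v in \<open>auto simp: edsm_choices_def\<close>)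
  qed
qed

lemma mds_greedy_run:
  assumes "sgraph V E" "N \<in> set_pmf (mds V E M)"
  shows "greedy_run mds_choices V E M N"
  using assms
proof (induction "card E" arbitrary: V E M rule: less_induct)
  case less
  show ?case
  proof (cases "E = {}")
    case True
    then show ?thesis
      using less.prems by (subst (asm) mds.simps) (simp add: greedy_run.stop)
  next
    case False
    note G = less.prems(1) False
    have "finite (mds_edges E)"
      using sgraph_finite_edges[OF G(1)] mds_edges_subset by (rule finite_subset[rotated])
    then have S: "set_pmf (pmf_of_set (mds_edges E)) = mds_edges E"
      using mds_edges_nonempty[OF G(2)] by (rule set_pmf_of_set[rotated])
    have "mds V E M = bind_pmf (pmf_of_set (mds_edges E)) (\<lambda>e.
          mds (V - e) (del_edges E e) (insert e M))"
      using G by (subst mds.simps) simp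
    then obtain e where e: "e \<in> mds_edges E"
      and N: "N \<in> set_pmf (mds (V - e) (del_edges E e) (insert e M))"
      using less.prems(2) S by auto
    have "card (del_edges E e) < card E"
      using card_del_edges_less[OF G(1)] e mds_edges_subset by blast
    then have "greedy_run mds_choices (V - e) (del_edges E e) (insert e M) N"
      using less.hyps sgraph_delete[OF G(1)] N by blast
    then show ?thesis
      by (rule greedy_run.step[rotated]) (use e in \<open>simp add: mds_choices_def\<close>)
  qed
qed

text \<open>Each picked edge uses up at least one node of the vertex cover \<open>H\<close>, and
  \<open>H - e\<close> covers the edges that survive. It is applied with the hubs as
  \<open>H\<close>, once all middle edges are gone.\<close>

lemma greedy_run_card_le_cover:
  assumes "greedy_run S V E M N" "\<And>V E. S V E \<subseteq> E"
    and "finite H" "\<And>e. e \<in> E \<Longrightarrow> e \<inter> H \<noteq> {}"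
  shows "card N \<le> card M + card H"
  using assms(1,3,4)
proof (induction arbitrary: H)
  case (stop V M)
  then show ?case by simp
next
  case (step e V E M N)
  have "e \<in> E" using step.hyps(1) assms(2) by blast
  then obtain h where h: "h \<in> e" "h \<in> H" using step.prems(2) by blast
  have "card N \<le> card (insert e M) + card (H - e)"
  proof (rule step.IH)
    show "f \<inter> (H - e) \<noteq> {}" if "f \<in> del_edges E e" for f
      using that step.prems(2)[of f] by (auto simp: del_edges_def)
  qed (use step.prems(1) in simp)
  \<comment> \<open>No finiteness of \<open>M\<close> is required, since \<open>card\<close> is 0 on
    infinite sets.\<close>
  moreover have "card (insert e M) \<le> Suc (card M)"
    by (metis card_insert_if card.infinite finite_insert le_SucI le_refl)
  moreover have "card (H - e) < card H"
    using h step.prems(1) by (intro psubset_card_mono) auto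
  ultimately show ?case by linarith
qed

section \<open>Choices when some edge has both ends of minimum degree\<close>

lemma minimizers_le: "x \<in> minimizers f S \<Longrightarrow> y \<in> S \<Longrightarrow> f x \<le> f y"
  by (fastforce simp: minimizers_def is_arg_min_def)

text \<open>An edge at \<open>v\<close> is determined by its other end. This reduces degrees in the
  instance to explicit neighborhoods.\<close>

lemma vdegree_eq_card_neighbors:
  assumes "sgraph V E"
  shows "vdegree E v = card (neighbors E v)"
proof -
  have "{e \<in> E. v \<in> e} = (\<lambda>w. {v, w}) ` neighbors E v"
  proof
    show "{e \<in> E. v \<in> e} \<subseteq> (\<lambda>w. {v, w}) ` neighbors E v"
    proof clarify
      fix e assume e: "e \<in> E" "v \<in> e"
      then have "card e = 2" using assms by (auto simp: sgraph_def)
      then obtain w where "e = {v, w}" using e(2) by (auto simp: card_2_iff)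
      then show "e \<in> (\<lambda>w. {v, w}) ` neighbors E v" using e by (auto simp: neighbors_def)
    qed
  qed (auto simp: neighbors_def)
  moreover have "inj_on (\<lambda>w. {v, w}) (neighbors E v)"
    by (auto simp: inj_on_def doubleton_eq_iff)
  ultimately show ?thesis by (simp add: vdegree_def card_image)
qed

text \<open>The edge \<open>f\<close> shows that the minimum degree \<open>d\<close> is attained, so
  EDSM starts at a node of degree \<open>d\<close>. By \<open>nbr\<close> that node has a neighbor
  of degree \<open>d\<close>, which forces the same degree on the chosen partner.\<close>

lemma edsm_choices_min_degree:
  assumes "sgraph V E"
    and min: "\<And>e v. e \<in> E \<Longrightarrow> v \<in> e \<Longrightarrow> d \<le> vdegree E v"
    and ex: "f \<in> E" "\<And>v. v \<in> f \<Longrightarrow> vdegree E v = d"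
    and nbr: "\<And>e v. e \<in> E \<Longrightarrow> v \<in> e \<Longrightarrow> vdegree E v = d \<Longrightarrow> \<exists>w\<in>neighbors E v. vdegree E w = d"
    and e: "e \<in> edsm_choices V E" "v \<in> e"
  shows "vdegree E v = d"
proof -
  obtain x y where xy: "x \<in> edsm_nodes V E" "y \<in> edsm_partners E x" "e = {x, y}"
    using e by (auto simp: edsm_choices_def)
  have E: "{x, y} \<in> E" using xy(2) by (rule edsm_partners_edge)
  have "f \<subseteq> V" "card f = 2" using ex(1) assms(1) by (auto simp: sgraph_def)
  then obtain z where z: "z \<in> f" "z \<in> V" by (auto simp: card_2_iff)
  have "vdegree E z > 0"
    using sgraph_finite_edges[OF assms(1)] ex(1) z(1) by (auto simp: vdegree_def card_gt_0_iff)
  then have "vdegree E x \<le> vdegree E z"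
    using xy(1) z(2) by (auto simp: edsm_nodes_def intro: minimizers_le)
  then have dx: "vdegree E x = d" using ex(2)[OF z(1)] min[OF E, of x] by simp
  then obtain w where "w \<in> neighbors E x" "vdegree E w = d" using nbr[OF E, of x] by auto
  then have "vdegree E y \<le> d" using xy(2) by (metis edsm_partners_def minimizers_le)
  then have "vdegree E y = d" using min[OF E, of y] by simp
  then show ?thesis using dx xy(3) e(2) by auto
qed

text \<open>Every degree sum is at least \<open>2 * d\<close> and \<open>f\<close> attains this
  value, so a minimizing edge has no slack at either end.\<close>

lemma mds_choices_min_degree:
  assumes "sgraph V E"
    and min: "\<And>e v. e \<in> E \<Longrightarrow> v \<in> e \<Longrightarrow> d \<le> vdegree E v"
    and ex: "f \<in> E" "\<And>v. v \<in> f \<Longrightarrow> vdegree E v = d"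
    and e: "e \<in> mds_choices V E" "v \<in> e"
  shows "vdegree E v = d"
proof -
  have eE: "e \<in> E" using e(1) mds_choices_subset by blast
  have le: "(\<Sum>v\<in>e. vdegree E v) \<le> (\<Sum>v\<in>f. vdegree E v)"
    using e(1) ex(1) unfolding mds_choices_def mds_edges_def by (rule minimizers_le)
  have "card e = 2" "card f = 2" using assms(1) eE ex(1) by (auto simp: sgraph_def)
  then obtain x y where "e = {x, y}" "x \<noteq> y" and "(\<Sum>v\<in>f. vdegree E v) = 2 * d"
    using ex(2) by (auto simp: card_2_iff)
  then show ?thesis using le min[OF eE, of x] min[OF eE, of y] e(2) by auto
qed

section \<open>The bad instance\<close>

text \<open>Kind 0 are the inner nodes of the paths, kind 1 the path ends and kind 2 the hubs; the
  Boolean tells to which half of a path a node belongs.\<close>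

definition node :: "nat \<Rightarrow> bool \<Rightarrow> nat \<Rightarrow> nat" where
  "node t s i = prod_encode (t, prod_encode (of_bool s, i))"

lemma node_eq_iff [simp]: "node t s i = node t' s' i' \<longleftrightarrow> t = t' \<and> s = s' \<and> i = i'"
  by (auto simp: node_def)

definition middle_edge :: "nat \<Rightarrow> nat set" where
  "middle_edge i = {node 0 False i, node 0 True i}"

definition bad_nodes :: "nat \<Rightarrow> nat set" where
  "bad_nodes n = (\<Union>s. node 0 s ` {..<n} \<union> node 1 s ` {..<n} \<union> node 2 s ` {..<3})"

text \<open>The edges that remain when the middle edges of exactly the paths in \<open>I\<close> have not been
  picked yet.\<close>

definition bad_edges :: "nat \<Rightarrow> nat set \<Rightarrow> nat set set" where
  "bad_edges n I = middle_edge ` I \<union> {{node 0 s i, node 1 s i} |s i. i \<in> I}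
     \<union> {{node 1 s i, node 2 s k} |s i k. i < n \<and> k < 3}"

lemma bad_edges_cases [consumes 1, case_names middle outer hub]:
  assumes "e \<in> bad_edges n I"
  obtains i where "i \<in> I" "e = middle_edge i"
  | s i where "i \<in> I" "e = {node 0 s i, node 1 s i}"
  | s i k where "i < n" "k < 3" "e = {node 1 s i, node 2 s k}"
  using assms unfolding bad_edges_def by blast

lemma node_in_bad_nodes_iff:
  "node t s i \<in> bad_nodes n \<longleftrightarrow> (t = 0 \<or> t = 1) \<and> i < n \<or> t = 2 \<and> i < 3"
  by (cases s) (auto simp: bad_nodes_def UNIV_bool image_iff)

lemma sgraph_bad:
  assumes "I \<subseteq> {..<n}"
  shows "sgraph (bad_nodes n) (bad_edges n I)"
proof -
  have "e \<subseteq> bad_nodes n \<and> card e = 2" if "e \<in> bad_edges n I" for e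
    using that
  proof (cases rule: bad_edges_cases)
    case (middle i)
    then show ?thesis using assms by (auto simp: middle_edge_def node_in_bad_nodes_iff)
  next
    case (outer s i)
    then show ?thesis using assms by (auto simp: node_in_bad_nodes_iff)
  next
    case (hub s i k)
    then show ?thesis by (simp add: node_in_bad_nodes_iff)
  qed
  moreover have "finite (bad_nodes n)" by (simp add: bad_nodes_def)
  ultimately show ?thesis by (simp add: sgraph_def)
qed

lemma bipartite_bad:
  assumes "I \<subseteq> {..<n}"
  shows "bipartite (bad_nodes n) (bad_edges n I)"
proof -
  \<comment> \<open>Two-coloring by the half of the path xor the parity of the kind: a middle edge
    flips only the half, while outer and hub edges keep the half and change the kind by one.\<close>
  define C where "C = {node t s i |t s i. s = odd t}"
  have C: "node t s i \<in> C \<longleftrightarrow> s = odd t" for t s i by (auto simp: C_def)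
  have split: "\<exists>a\<in>bad_nodes n \<inter> C. \<exists>b\<in>bad_nodes n - C. {p, q} = {a, b}"
    if e: "{p, q} \<in> bad_edges n I" and pq: "p \<in> C \<longleftrightarrow> q \<notin> C" for p q
  proof -
    have "p \<in> bad_nodes n" "q \<in> bad_nodes n" using sgraph_bad[OF assms] e by (auto simp: sgraph_def)
    then show ?thesis
    proof (cases "p \<in> C")
      case True
      then show ?thesis using pq \<open>p \<in> bad_nodes n\<close> \<open>q \<in> bad_nodes n\<close> by blast
    next
      case False
      then show ?thesis
        using pq \<open>p \<in> bad_nodes n\<close> \<open>q \<in> bad_nodes n\<close> by (subst insert_commute) blast
    qed
  qed
  have "\<exists>a\<in>bad_nodes n \<inter> C. \<exists>b\<in>bad_nodes n - C. e = {a, b}" if e: "e \<in> bad_edges n I" for e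
    using e
  proof (cases rule: bad_edges_cases)
    case (middle i)
    show ?thesis
      using e unfolding middle middle_edge_def by (rule split) (simp add: C)
  next
    case (outer s i)
    show ?thesis
      using e unfolding outer by (rule split) (simp add: C)
  next
    case (hub s i k)
    show ?thesis
      using e unfolding hub by (rule split) (simp add: C)
  qed
  then show ?thesis
    unfolding bipartite_def
    by (intro exI[of _ "bad_nodes n \<inter> C"] exI[of _ "bad_nodes n - C"] conjI ballI) auto
qed

section \<open>Neighborhoods and degrees in the instance\<close>

lemma neighbors_bad_inner:
  "i \<in> I \<Longrightarrow> neighbors (bad_edges n I) (node 0 s i) = {node 0 (\<not> s) i, node 1 s i}"
  by (cases s) (auto simp: neighbors_def bad_edges_def middle_edge_def doubleton_eq_iff)

text \<open>The inclusion suffices, as only a lower bound on the degree is wanted. It does not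
  depend on \<open>I\<close>, so path ends stay above degree 2 throughout the first phase.\<close>

lemma neighbors_bad_end:
  "i < n \<Longrightarrow> node 2 s ` {..<3} \<subseteq> neighbors (bad_edges n I) (node 1 s i)"
  by (auto simp: neighbors_def bad_edges_def)

lemma neighbors_bad_hub:
  "k < 3 \<Longrightarrow> node 1 s ` {..<n} \<subseteq> neighbors (bad_edges n I) (node 2 s k)"
  by (auto simp: neighbors_def bad_edges_def doubleton_eq_iff)

lemma card_node_image [simp]: "card (node t s ` A) = card A"
  by (rule card_image) (simp add: inj_on_def)

text \<open>\<open>V\<close> is arbitrary because the node set shrinks along a run while the edges
  keep the form \<open>bad_edges n I\<close>. The bound \<open>3 \<le> n\<close> gives the hubs
  degree at least 3.\<close>

context
  fixes n :: nat and I :: "nat set" and V :: "nat set"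
  assumes n: "3 \<le> n" and I: "I \<subseteq> {..<n}" and G: "sgraph V (bad_edges n I)"
begin

lemma finite_neighbors_bad: "finite (neighbors (bad_edges n I) v)"
  by (rule finite_subset[of _ V]) (use G in \<open>auto simp: neighbors_def sgraph_def\<close>)

lemma vdegree_bad_inner: "i \<in> I \<Longrightarrow> vdegree (bad_edges n I) (node 0 s i) = 2"
  by (simp add: vdegree_eq_card_neighbors[OF G] neighbors_bad_inner)

lemma vdegree_bad_end: "i < n \<Longrightarrow> 3 \<le> vdegree (bad_edges n I) (node 1 s i)"
  using card_mono[OF finite_neighbors_bad neighbors_bad_end]
  by (simp add: vdegree_eq_card_neighbors[OF G])

lemma vdegree_bad_hub: "k < 3 \<Longrightarrow> 3 \<le> vdegree (bad_edges n I) (node 2 s k)"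
  using card_mono[OF finite_neighbors_bad neighbors_bad_hub[of k s]] n
  by (simp add: vdegree_eq_card_neighbors[OF G])

lemma vdegree_bad_ge:
  assumes "e \<in> bad_edges n I" "v \<in> e"
  shows "2 \<le> vdegree (bad_edges n I) v"
  using assms(1)
proof (cases rule: bad_edges_cases)
  case (middle i)
  then show ?thesis using assms(2) vdegree_bad_inner by (auto simp: middle_edge_def)
next
  case (outer s i)
  then show ?thesis using assms(2) vdegree_bad_inner[of i s] vdegree_bad_end[of i s] I by auto
next
  case (hub s i k)
  then show ?thesis using assms(2) vdegree_bad_end[of i s] vdegree_bad_hub[of k s] by auto
qed

text \<open>Path ends and hubs have degree at least 3, so only inner nodes remain. This supplies the
  neighbor condition of \<open>edsm_choices_min_degree\<close>.\<close>

lemma vdegree_bad_eq_2: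
  assumes "e \<in> bad_edges n I" "v \<in> e" "vdegree (bad_edges n I) v = 2"
  obtains s i where "i \<in> I" "v = node 0 s i"
  using assms(1)
proof (cases rule: bad_edges_cases)
  case (middle i)
  then show ?thesis using assms(2) that by (auto simp: middle_edge_def)
next
  case (outer s i)
  then show ?thesis using assms(2,3) vdegree_bad_end[of i s] I that by auto
next
  case (hub s i k)
  then show ?thesis using assms(2,3) vdegree_bad_end[of i s] vdegree_bad_hub[of k s] by auto
qed

text \<open>Outer and hub edges both contain a path end, whose degree is at least 3.\<close>

lemma bad_edge_degree_2:
  assumes "e \<in> bad_edges n I" "\<And>v. v \<in> e \<Longrightarrow> vdegree (bad_edges n I) v = 2"
  shows "e \<in> middle_edge ` I"
  using assms(1)
proof (cases rule: bad_edges_cases)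
  case (outer s i)
  then show ?thesis using assms(2)[of "node 1 s i"] vdegree_bad_end[of i s] I by auto
next
  case (hub s i k)
  then show ?thesis using assms(2)[of "node 1 s i"] vdegree_bad_end[of i s] by auto
qed simp

lemma middle_edge_degree_2:
  "i \<in> I \<Longrightarrow> v \<in> middle_edge i \<Longrightarrow> vdegree (bad_edges n I) v = 2"
  by (auto simp: middle_edge_def vdegree_bad_inner)

text \<open>From an inner node, EDSM prefers the other inner node of degree 2 to the path end. Ties
  therefore only decide which path is taken and from which side.\<close>

lemma edsm_choices_bad:
  assumes "I \<noteq> {}"
  shows "edsm_choices V (bad_edges n I) \<subseteq> middle_edge ` I"
proof
  fix e assume e: "e \<in> edsm_choices V (bad_edges n I)"
  obtain i where i: "i \<in> I" using assms by blast
  show "e \<in> middle_edge ` I"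
  proof (rule bad_edge_degree_2)
    show "e \<in> bad_edges n I" using e edsm_choices_subset by blast
    show "vdegree (bad_edges n I) v = 2" if v: "v \<in> e" for v
    proof (rule edsm_choices_min_degree[OF G])
      show "e \<in> edsm_choices V (bad_edges n I)" "v \<in> e" by fact+
      show "2 \<le> vdegree (bad_edges n I) u" if "f \<in> bad_edges n I" "u \<in> f" for f u
        using that by (rule vdegree_bad_ge)
      show "middle_edge i \<in> bad_edges n I" using i by (simp add: bad_edges_def)
      show "\<exists>w\<in>neighbors (bad_edges n I) u. vdegree (bad_edges n I) w = 2"
        if u: "f \<in> bad_edges n I" "u \<in> f" "vdegree (bad_edges n I) u = 2" for f u
      proof -
        obtain s j where "j \<in> I" "u = node 0 s j" by (rule vdegree_bad_eq_2[OF u])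
        then show ?thesis by (simp add: neighbors_bad_inner vdegree_bad_inner)
      qed
      show "vdegree (bad_edges n I) u = 2" if "u \<in> middle_edge i" for u
        using i that by (rule middle_edge_degree_2)
    qed
  qed
qed

lemma mds_choices_bad:
  assumes "I \<noteq> {}"
  shows "mds_choices V (bad_edges n I) \<subseteq> middle_edge ` I"
proof
  fix e assume e: "e \<in> mds_choices V (bad_edges n I)"
  obtain i where i: "i \<in> I" using assms by blast
  show "e \<in> middle_edge ` I"
  proof (rule bad_edge_degree_2)
    show "e \<in> bad_edges n I" using e mds_choices_subset by blast
    show "vdegree (bad_edges n I) v = 2" if v: "v \<in> e" for v
    proof (rule mds_choices_min_degree[OF G])
      show "e \<in> mds_choices V (bad_edges n I)" "v \<in> e" by fact+
      show "2 \<le> vdegree (bad_edges n I) u" if "f \<in> bad_edges n I" "u \<in> f" for f u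
        using that by (rule vdegree_bad_ge)
      show "middle_edge i \<in> bad_edges n I" using i by (simp add: bad_edges_def)
      show "vdegree (bad_edges n I) u = 2" if "u \<in> middle_edge i" for u
        using i that by (rule middle_edge_degree_2)
    qed
  qed
qed

end

section \<open>Size of the matching found on the instance\<close>

text \<open>The family is closed under the steps of the first phase: the outer edges of path
  \<open>i\<close> disappear with its inner nodes, and all hub edges survive.\<close>

lemma del_edges_bad:
  "del_edges (bad_edges n I) (middle_edge i) = bad_edges n (I - {i})" (is "?L = ?R")
proof
  show "?L \<subseteq> ?R"
  proof
    fix e assume "e \<in> ?L"
    then have e: "e \<in> bad_edges n I" and d: "e \<inter> middle_edge i = {}"
      by (auto simp: del_edges_def)
    from e show "e \<in> ?R"
    proof (cases rule: bad_edges_cases)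
      case (middle j)
      then have "j \<noteq> i" using d by (auto simp: middle_edge_def)
      then show ?thesis using middle by (simp add: bad_edges_def)
    next
      case (outer s j)
      then have "j \<noteq> i" using d by (cases s) (auto simp: middle_edge_def)
      then show ?thesis using outer by (auto simp: bad_edges_def)
    qed (auto simp: bad_edges_def)
  qed
  show "?R \<subseteq> ?L"
    by (auto simp: del_edges_def bad_edges_def middle_edge_def)
qed

text \<open>Each middle edge pick adds one edge and removes one index from \<open>I\<close>. When
  \<open>I\<close> is empty, the six hubs cover what is left, which accounts for the constant
  6.\<close>

lemma greedy_run_bad:
  assumes S: "\<And>V E. S V E \<subseteq> E"
    and middle: "\<And>V I. I \<subseteq> {..<n} \<Longrightarrow> I \<noteq> {} \<Longrightarrow> sgraph V (bad_edges n I) \<Longrightarrow>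
      S V (bad_edges n I) \<subseteq> middle_edge ` I"
    and "greedy_run S V (bad_edges n I) M N" "I \<subseteq> {..<n}" "sgraph V (bad_edges n I)"
  shows "card N \<le> card M + card I + 6"
  using assms(3-)
proof (induction "card I" arbitrary: I V M)
  case 0
  \<comment> \<open>Cardinality 0 means empty here because \<open>I\<close> lies in a finite
    set.\<close>
  then have "I = {}" by (auto dest: finite_subset)
  let ?H = "node 2 False ` {..<3} \<union> node 2 True ` {..<3}"
  have "card N \<le> card M + card ?H"
  proof (rule greedy_run_card_le_cover[OF 0(2) S])
    show "e \<inter> ?H \<noteq> {}" if "e \<in> bad_edges n I" for e
      using that
    proof (cases rule: bad_edges_cases)
      case (hub s i k)
      then show ?thesis by (cases s) auto
    qed (use \<open>I = {}\<close> in auto)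
  qed auto
  also have "card ?H \<le> 6"
    using card_Un_le[of "node 2 False ` {..<3}" "node 2 True ` {..<3}"] by simp
  finally show ?case by simp
next
  case (Suc m)
  from Suc.prems(1) show ?case
  proof cases
    case stop
    then show ?thesis by simp
  next
    case (step e)
    have "I \<noteq> {}" using Suc.hyps(2) by auto
    then obtain i where i: "i \<in> I" "e = middle_edge i"
      using middle Suc.prems step(1) by blast
    have m: "card (I - {i}) = m" using Suc.hyps(2) i(1) by simp
    have "card N \<le> card (insert e M) + card (I - {i}) + 6"
    proof (rule Suc.hyps(1))
      show "greedy_run S (V - e) (bad_edges n (I - {i})) (insert e M) N"
        using step(2) i(2) by (simp add: del_edges_bad)
      show "sgraph (V - e) (bad_edges n (I - {i}))"
        using sgraph_delete[OF Suc.prems(3), of e] i(2) by (simp add: del_edges_bad)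
    qed (use m Suc.prems(2) in auto)
    moreover have "card (insert e M) \<le> Suc (card M)"
      by (metis card_insert_if card.infinite finite_insert le_SucI le_refl)
    ultimately show ?thesis using m Suc.hyps(2) by linarith
  qed
qed

section \<open>Matching number and the expected ratio\<close>

lemma card_le_matching_number:
  assumes "finite E" "matching E M"
  shows "card M \<le> matching_number E"
  unfolding matching_number_def
proof (rule Max_ge)
  have "{M. matching E M} \<subseteq> Pow E" by (auto simp: matching_def)
  then show "finite (card ` {M. matching E M})" using assms(1) finite_subset by blast
qed (use assms(2) in simp)

text \<open>The outer edges, two for each path, are pairwise disjoint.\<close>

lemma matching_number_bad: "2 * n \<le> matching_number (bad_edges n {..<n})"
proof -
  define f where "f = (\<lambda>(s, i). {node 0 s i, node 1 s i})"
  let ?A = "(UNIV :: bool set) \<times> {..<n}"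
  have "inj_on f ?A" by (auto simp: inj_on_def f_def doubleton_eq_iff)
  then have "card (f ` ?A) = 2 * n" by (simp add: card_image card_cartesian_product)
  moreover have "matching (bad_edges n {..<n}) (f ` ?A)"
    by (auto simp: matching_def f_def bad_edges_def pairwise_def disjnt_def)
  moreover have "finite (bad_edges n {..<n})"
    by (rule sgraph_finite_edges[OF sgraph_bad[OF subset_refl]])
  ultimately show ?thesis using card_le_matching_number by metis
qed

text \<open>Nonnegativity together with the upper bound makes \<open>f\<close> bounded on the
  support and hence integrable, without an appeal to finite support.\<close>

lemma expectation_le_of_set_pmf:
  fixes f :: "'a \<Rightarrow> real"
  assumes "\<And>x. x \<in> set_pmf p \<Longrightarrow> 0 \<le> f x" "\<And>x. x \<in> set_pmf p \<Longrightarrow> f x \<le> c"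
  shows "measure_pmf.expectation p f \<le> c"
proof (rule measure_pmf.integral_le_const)
  show "integrable p f"
    by (rule measure_pmf.integrable_const_bound[where B = c]) (use assms in \<open>auto simp: AE_measure_pmf_iff\<close>)
qed (use assms in \<open>simp add: AE_measure_pmf_iff\<close>)

theorem theorem2:
  fixes \<epsilon> :: real
  assumes "\<epsilon> > 0"
  shows "\<exists>(V :: nat set) (E :: nat set set).
    sgraph V E \<and> bipartite V E \<and>
    edsm_expected_size V E < (1 / 2 + \<epsilon>) * real (matching_number E) \<and>
    mds_expected_size V E < (1 / 2 + \<epsilon>) * real (matching_number E)"
proof -
  \<comment> \<open>The goal \<open>n + 6 < (1 / 2 + \<epsilon>) * (2 * n)\<close> amounts to
    \<open>6 < 2 * \<epsilon> * n\<close>, hence the threshold \<open>3 / \<epsilon>\<close>. The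
    maximum with 3 below secures the hub degrees.\<close>
  obtain m :: nat where m: "3 / \<epsilon> < real m" using reals_Archimedean2 by blast
  define n where "n = max 3 m"
  have n: "3 \<le> n" and "3 / \<epsilon> < real n" using m by (auto simp: n_def)
  then have "n + 6 < (1 / 2 + \<epsilon>) * real (2 * n)" using assms by (simp add: field_simps)
  also have "\<dots> \<le> (1 / 2 + \<epsilon>) * real (matching_number (bad_edges n {..<n}))"
    using assms matching_number_bad by (intro mult_left_mono) (auto simp del: of_nat_mult)
  finally have bound: "n + 6 < (1 / 2 + \<epsilon>) * real (matching_number (bad_edges n {..<n}))" .
  note G = sgraph_bad[OF subset_refl, of n]
  have "card N \<le> n + 6" if "N \<in> set_pmf (edsm (bad_nodes n) (bad_edges n {..<n}) {})" for N
    using greedy_run_bad[OF edsm_choices_subset edsm_choices_bad[OF n] edsm_greedy_run[OF G that] _ G]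
    by simp
  then have "edsm_expected_size (bad_nodes n) (bad_edges n {..<n}) \<le> n + 6"
    unfolding edsm_expected_size_def by (intro expectation_le_of_set_pmf) force+
  moreover have "card N \<le> n + 6" if "N \<in> set_pmf (mds (bad_nodes n) (bad_edges n {..<n}) {})" for N
    using greedy_run_bad[OF mds_choices_subset mds_choices_bad[OF n] mds_greedy_run[OF G that] _ G]
    by simp
  then have "mds_expected_size (bad_nodes n) (bad_edges n {..<n}) \<le> n + 6"
    unfolding mds_expected_size_def by (intro expectation_le_of_set_pmf) force+
  ultimately show ?thesis
    using G bipartite_bad[OF subset_refl, of n] bound by (meson le_less_trans)
qed

end
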